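(* Let $n$ be odd, and let $\mathcal{A}$ be a truncated Hankel tensor of order $m$ and dimension $n$ with generating vector $\mathbf{v} = (v_0, 0, \ldots, 0, v_{\frac{(n-1)m}{2}}, 0, \ldots, 0, v_{(n-1)m})^\top$. Suppose that $v_{(i-1)m} \ge 0$ for all $i \in \{1,\ldots,n\}$. If $v_{\frac{(n-1)m}{2}} = 0$, then the truncated Hankel tensor $\mathcal{A}$ is a strong Hankel tensor, and furthermore an SOS Hankel tensor if $m$ is even. If $v_{\frac{(n-1)m}{2}} > 0$, then $\mathcal{A}$ is not a strong Hankel tensor.
   Context: A Hankel tensor of order $m$ and dimension $n$ with generating vector $\mathbf{v}=(v_0,\ldots,v_{(n-1)m})^\top$ is the real symmetric tensor $\mathcal{A}=(a_{i_1\cdots i_m})$ with $a_{i_1\cdots i_m}=v_{i_1+\cdots+i_m-m}$ for $i_1,\ldots,i_m\in\{1,\ldots,n\}$. It is called a truncated Hankel tensor if $n$ is odd and all entries of $\mathbf{v}$ other than $v_0$, $v_{\frac{(n-1)m}{2}}$, $v_{(n-1)m}$ are zero. Since $n$ is odd, $(n-1)m$ is even, and the associated Hankel matrix is the $\frac{(n-1)m+2}{2}\times\frac{(n-1)m+2}{2}$ matrix $A=(a_{ij})$ with $a_{ij}=v_{i+j-2}$; $\mathcal{A}$ is called a strong Hankel tensor if $A$ is positive semi-definite. For even $m=2k$, $\mathcal{A}$ is called SOS (sum-of-squares) if the homogeneous polynomial $f(\mathbf{x})=\sum_{i_1,\ldots,i_m=1}^n a_{i_1\cdots i_m}x_{i_1}\cdots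 x_{i_m}$ is a finite sum of squares of real homogeneous polynomials of degree $k$.
   Formalization: The last claim (positive middle entry implies not strong) is stated only for (n-1)m > 4; for smaller (n-1)m it fails, e.g. n=3, m=2, v=(1,0,1,0,1) gives a positive semi-definite Hankel matrix. *)

theory Defs
  imports "Jordan_Normal_Form.Matrix" "HOL-Library.Poly_Mapping"
begin

text \<open>Tensors of order \<open>m\<close> and dimension \<open>n\<close> are functions on index lists; only their values on
  \<open>tensor_indices m n\<close> are ever used. Tensor indices are 1-based, whereas vectors and matrices are
  0-based.\<close>

definition tensor_indices :: "nat \<Rightarrow> nat \<Rightarrow> nat list set" where
  "tensor_indices m n = {is. length is = m \<and> set is \<subseteq> {1..n}}"

definition hankel_tensor :: "nat \<Rightarrow> nat \<Rightarrow> real vec \<Rightarrow> (nat list \<Rightarrow> real) \<Rightarrow> bool" where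
  "hankel_tensor m n v A \<longleftrightarrow>
     v \<in> carrier_vec ((n - 1) * m + 1) \<and>
     (\<forall>is \<in> tensor_indices m n. A is = v $ (sum_list is - m))"

definition truncated_hankel_tensor :: "nat \<Rightarrow> nat \<Rightarrow> real vec \<Rightarrow> (nat list \<Rightarrow> real) \<Rightarrow> bool" where
  "truncated_hankel_tensor m n v A \<longleftrightarrow>
     odd n \<and> hankel_tensor m n v A \<and>
     (\<forall>k \<le> (n - 1) * m. k \<notin> {0, (n - 1) * m div 2, (n - 1) * m} \<longrightarrow> v $ k = 0)"

definition hankel_matrix :: "nat \<Rightarrow> nat \<Rightarrow> real vec \<Rightarrow> real mat" where
  "hankel_matrix m n v =
     mat (((n - 1) * m + 2) div 2) (((n - 1) * m + 2) div 2) (\<lambda>(i, j). v $ (i + j))"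

definition positive_semidefinite :: "real mat \<Rightarrow> bool" where
  "positive_semidefinite M \<longleftrightarrow>
     square_mat M \<and> transpose_mat M = M \<and>
     (\<forall>x \<in> carrier_vec (dim_row M). 0 \<le> x \<bullet> (M *\<^sub>v x))"

text \<open>The generating vector of a tensor is unique when \<open>n \<ge> 1\<close>, since the sums of index lists
  then attain every value between \<open>m\<close> and \<open>n * m\<close>. The existential therefore just refers to it.\<close>

definition strong_hankel_tensor :: "nat \<Rightarrow> nat \<Rightarrow> (nat list \<Rightarrow> real) \<Rightarrow> bool" where
  "strong_hankel_tensor m n A \<longleftrightarrow>
     even ((n - 1) * m) \<and>
     (\<exists>v. hankel_tensor m n v A \<and> positive_semidefinite (hankel_matrix m n v))"

text \<open>A polynomial is a finitely supported map from monomials to coefficients, a monomial being a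
  finitely supported map from variable numbers to exponents; the ring operations are those of
  \<open>Poly_Mapping\<close>.\<close>

type_synonym real_mpoly = "(nat \<Rightarrow>\<^sub>0 nat) \<Rightarrow>\<^sub>0 real"

definition homogeneous :: "nat \<Rightarrow> nat \<Rightarrow> real_mpoly \<Rightarrow> bool" where
  "homogeneous n d p \<longleftrightarrow>
     (\<forall>t \<in> Poly_Mapping.keys p.
        Poly_Mapping.keys t \<subseteq> {1..n} \<and>
        (\<Sum>i \<in> Poly_Mapping.keys t. Poly_Mapping.lookup t i) = d)"

text \<open>The monomial of an index list \<open>[i\<^sub>1, \<dots>, i\<^sub>m]\<close> has exponent \<open>count_list is i\<close> at the variable
  \<open>i\<close>.\<close>

definition tensor_poly :: "nat \<Rightarrow> nat \<Rightarrow> (nat list \<Rightarrow> real) \<Rightarrow> real_mpoly" where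
  "tensor_poly m n A =
     (\<Sum>is \<in> tensor_indices m n.
        Poly_Mapping.single (\<Sum>i \<leftarrow> is. Poly_Mapping.single i 1) (A is))"

definition sos_tensor :: "nat \<Rightarrow> nat \<Rightarrow> (nat list \<Rightarrow> real) \<Rightarrow> bool" where
  "sos_tensor m n A \<longleftrightarrow>
     even m \<and>
     (\<exists>qs. (\<forall>q \<in> set qs. homogeneous n (m div 2) q) \<and>
           tensor_poly m n A = (\<Sum>q \<leftarrow> qs. q\<^sup>2))"

text \<open>For \<open>(n - 1) * m \<le> 4\<close> a truncated Hankel tensor with positive middle entry can be strong:
  with \<open>v\<^sub>0\<close>, the middle and the last entry all \<open>1\<close>, the associated matrix is \<open>(1)\<close>, the \<open>2 \<times> 2\<close>
  all-ones matrix, or the \<open>3 \<times> 3\<close> matrix with rows \<open>(1,0,1)\<close>, \<open>(0,1,0)\<close>, \<open>(1,0,1)\<close>, and all three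
  are positive semi-definite. For \<open>(n - 1) * m > 4\<close>, in particular whenever \<open>n \<ge> 3\<close> and
  \<open>m \<ge> 3\<close>, this cannot happen.\<close>

end

theory Submission
  imports Defs
begin

text \<open>
  Write \<open>N = (n - 1) * m\<close> and \<open>h = N div 2\<close>, so that the associated Hankel matrix is indexed by
  \<open>0, \<dots>, h\<close>.

  If the middle entry \<open>v\<^sub>h\<close> vanishes, at most the two extreme entries of \<open>v\<close> are nonzero, and an
  extreme index sum forces all indices to be equal: \<open>i + j = 0\<close> or \<open>i + j = 2 * h\<close> with \<open>i, j \<le> h\<close> gives
  \<open>i = j\<close>, and likewise an index list over \<open>{1..n}\<close> with the smallest or the largest possible sum
  is constant. Hence the matrix and the tensor are both diagonal with nonnegative
  diagonal. A diagonal matrix of this kind is positive semi-definite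
  (\<open>positive_semidefinite_diagonalI\<close>), and for even order the polynomial of such a tensor is a
  combination of the even powers \<open>x\<^sub>i\<^sup>m\<close> with nonnegative coefficients, hence a sum of squares
  (\<open>sos_tensor_diagonalI\<close>).

  If \<open>v\<^sub>h > 0\<close> and \<open>h \<ge> 3\<close>, the principal submatrix on the indices \<open>1\<close> and \<open>h - 1\<close> has
  off-diagonal entries \<open>v\<^sub>h\<close> and diagonal entries \<open>v\<^sub>2\<close> and \<open>v\<^bsub>2 h - 2\<^esub>\<close>, which are zero because
  neither \<open>2\<close> nor \<open>2 * h - 2\<close> is one of \<open>0\<close>, \<open>h\<close>, \<open>2 * h\<close>. Such a matrix is indefinite
  (\<open>positive_semidefinite_offdiag_le\<close>). Strongness may be tested on the given \<open>v\<close>, since the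
  tensor determines its generating vector (\<open>hankel_tensor_generating_vector_unique\<close>).
\<close>

lemma positive_semidefinite_diagonalI:
  assumes M: "M \<in> carrier_mat d d"
    and off: "\<And>i j. i < d \<Longrightarrow> j < d \<Longrightarrow> i \<noteq> j \<Longrightarrow> M $$ (i, j) = 0"
    and diag: "\<And>i. i < d \<Longrightarrow> 0 \<le> M $$ (i, i)"
  shows "positive_semidefinite M"
  unfolding positive_semidefinite_def
proof (intro conjI ballI)
  show "square_mat M" using M by simp
  show "transpose_mat M = M"
  proof (rule eq_matI)
    fix i j assume "i < dim_row M" "j < dim_col M"
    then show "transpose_mat M $$ (i, j) = M $$ (i, j)"
      using M off by (cases "i = j") auto
  qed (use M in auto)
  fix x :: "real vec" assume x: "x \<in> carrier_vec (dim_row M)"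
  have "(M *\<^sub>v x) $ i = M $$ (i, i) * x $ i" if i: "i < d" for i
  proof -
    have "(M *\<^sub>v x) $ i = (\<Sum>j = 0..<d. M $$ (i, j) * x $ j)"
      using M x i by (simp add: scalar_prod_def)
    also have "\<dots> = (\<Sum>j \<in> {i}. M $$ (i, j) * x $ j)"
      by (rule sum.mono_neutral_right) (use i off in auto)
    finally show ?thesis by simp
  qed
  then have "x \<bullet> (M *\<^sub>v x) = (\<Sum>i = 0..<d. M $$ (i, i) * (x $ i)\<^sup>2)"
    using M by (simp add: scalar_prod_def power2_eq_square ac_simps)
  also have "\<dots> \<ge> 0"
    by (rule sum_nonneg) (use diag in simp)
  finally show "0 \<le> x \<bullet> (M *\<^sub>v x)" .
qed

text \<open>The inequality is the nonnegativity of the quadratic form at \<open>e\<^sub>i - e\<^sub>j\<close>.\<close>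

lemma positive_semidefinite_offdiag_le:
  assumes psd: "positive_semidefinite M" and i: "i < dim_row M" and j: "j < dim_row M"
  shows "2 * M $$ (i, j) \<le> M $$ (i, i) + M $$ (j, j)"
proof -
  define d where "d = dim_row M"
  have M: "M \<in> carrier_mat d d" and sym: "transpose_mat M = M"
    using psd by (auto simp: positive_semidefinite_def d_def)
  have ij: "i < d" "j < d" using i j by (simp_all add: d_def)
  define x :: "real vec" where "x = unit_vec d i - unit_vec d j"
  have unit: "M *\<^sub>v unit_vec d k = col M k" if "k < d" for k
    by (rule eq_vecI) (use M that in auto)
  have Mx: "M *\<^sub>v x = col M i - col M j"
    unfolding x_def using M ij
    by (subst mult_minus_distrib_mat_vec[OF M]) (auto simp: unit)
  have "x \<bullet> (M *\<^sub>v x) = (col M i - col M j) $ i - (col M i - col M j) $ j"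
    unfolding Mx unfolding x_def using M ij
    by (subst minus_scalar_prod_distrib[of _ d]) (auto simp del: index_minus_vec)
  then have "x \<bullet> (M *\<^sub>v x) = M $$ (i, i) - M $$ (i, j) - M $$ (j, i) + M $$ (j, j)"
    using M ij by auto
  moreover have "M $$ (j, i) = M $$ (i, j)"
    using arg_cong[OF sym, of "\<lambda>B. B $$ (i, j)"] M ij by simp
  moreover have "0 \<le> x \<bullet> (M *\<^sub>v x)"
    using psd by (auto simp: positive_semidefinite_def x_def d_def)
  ultimately show ?thesis by simp
qed

lemma finite_tensor_indices: "finite (tensor_indices m n)"
  using finite_lists_length_eq[of "{1..n}" m]
  by (simp add: tensor_indices_def conj_commute)

text \<open>Greedy choice: each index in turn absorbs as much of \<open>k\<close> as the bound \<open>n\<close> permits.\<close>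

lemma tensor_indices_sum_attained:
  assumes "1 \<le> n" "k \<le> (n - 1) * m"
  shows "\<exists>is \<in> tensor_indices m n. sum_list is = m + k"
  using assms(2)
proof (induction m arbitrary: k)
  case 0
  then show ?case by (auto simp: tensor_indices_def)
next
  case (Suc m)
  define e where "e = min k (n - 1)"
  have "k - e \<le> (n - 1) * m" using Suc.prems by (auto simp: e_def min_def)
  from Suc.IH[OF this] obtain js
    where "js \<in> tensor_indices m n" "sum_list js = m + (k - e)" by blast
  moreover have "e \<le> k" "e \<le> n - 1" by (simp_all add: e_def)
  ultimately show ?case using assms(1)
    by (intro bexI[of _ "Suc e # js"]) (auto simp: tensor_indices_def)
qed

lemma hankel_tensor_generating_vector_unique:
  assumes "1 \<le> n" and v: "hankel_tensor m n v A" and w: "hankel_tensor m n w A"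
  shows "w = v"
proof (rule eq_vecI)
  show "dim_vec w = dim_vec v" using v w by (auto simp: hankel_tensor_def)
  fix k assume "k < dim_vec v"
  then have "k \<le> (n - 1) * m" using v by (auto simp: hankel_tensor_def)
  from tensor_indices_sum_attained[OF assms(1) this] obtain "is"
    where "is \<in> tensor_indices m n" "sum_list is = m + k" by blast
  then show "w $ k = v $ k" using v w by (auto simp: hankel_tensor_def)
qed

lemma tensor_indices_sum_bounds:
  assumes "is \<in> tensor_indices m n"
  shows "m \<le> sum_list is" and "sum_list is \<le> n * m"
proof -
  have "length is \<le> sum_list is \<and> sum_list is \<le> n * length is"
    if "set is \<subseteq> {1..n}" for "is" :: "nat list"
    using that by (induction "is") auto
  then show "m \<le> sum_list is" and "sum_list is \<le> n * m"
    using assms by (auto simp: tensor_indices_def)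
qed

lemma tensor_indices_extreme_sum_constant:
  assumes "is \<in> tensor_indices m n" and "sum_list is = m \<or> sum_list is = n * m"
  shows "\<exists>i. is = replicate m i"
proof -
  have low: "is = replicate m 1"
    if "is \<in> tensor_indices m n" "sum_list is = m" for m and "is" :: "nat list"
    using that
  proof (induction m arbitrary: "is")
    case 0
    then show ?case by (simp add: tensor_indices_def)
  next
    case (Suc m)
    then obtain i js where is_eq: "is = i # js" and js: "js \<in> tensor_indices m n" and "1 \<le> i"
      by (cases "is") (auto simp: tensor_indices_def)
    then have "i = 1" "sum_list js = m"
      using Suc.prems tensor_indices_sum_bounds(1)[OF js] by auto
    then show ?case using Suc.IH[OF js] is_eq by simp
  qed
  have high: "is = replicate m n"
    if "is \<in> tensor_indices m n" "sum_list is = n * m" for m and "is" :: "nat list"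
    using that
  proof (induction m arbitrary: "is")
    case 0
    then show ?case by (simp add: tensor_indices_def)
  next
    case (Suc m)
    then obtain i js where is_eq: "is = i # js" and js: "js \<in> tensor_indices m n" and "i \<le> n"
      by (cases "is") (auto simp: tensor_indices_def)
    then have "i = n" "sum_list js = n * m"
      using Suc.prems tensor_indices_sum_bounds(2)[OF js] by auto
    then show ?case using Suc.IH[OF js] is_eq by simp
  qed
  show ?thesis using assms low high by blast
qed

text \<open>Only the monomials \<open>x\<^sub>i\<^sup>m\<close> occur, and a term \<open>a * x\<^sub>i\<^sup>m\<close> with \<open>a \<ge> 0\<close> and even \<open>m\<close> is the square
  of \<open>sqrt a * x\<^sub>i\<^bsup>m div 2\<^esup>\<close>.\<close>

lemma sos_tensor_diagonalI:
  assumes "even m"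
    and diag: "\<And>is. is \<in> tensor_indices m n \<Longrightarrow> A is \<noteq> 0 \<Longrightarrow> \<exists>i. is = replicate m i"
    and nonneg: "\<And>is. is \<in> tensor_indices m n \<Longrightarrow> 0 \<le> A is"
  shows "sos_tensor m n A"
proof -
  \<comment> \<open>For \<open>m = 0\<close> the only index list is empty; the value of \<open>hd []\<close> is harmless there, because
    \<open>single i 0\<close> is the trivial monomial for every \<open>i\<close>.\<close>
  define q :: "nat list \<Rightarrow> real_mpoly" where
    "q is = Poly_Mapping.single (Poly_Mapping.single (hd is) (m div 2)) (sqrt (A is))" for "is"
  have half: "m div 2 + m div 2 = m" using \<open>even m\<close> by auto
  have square: "Poly_Mapping.single (\<Sum>i \<leftarrow> is. Poly_Mapping.single i 1) (A is) = (q is)\<^sup>2"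
    if "is \<in> tensor_indices m n" for "is"
  proof (cases "A is = 0")
    case False
    then obtain i where is_eq: "is = replicate m i" using diag \<open>is \<in> _\<close> by blast
    have "(\<Sum>i \<leftarrow> replicate k i. Poly_Mapping.single i (1::nat)) = Poly_Mapping.single i k" for k
      by (induction k) (simp_all flip: single_add)
    then have "(\<Sum>i \<leftarrow> is. Poly_Mapping.single i (1::nat)) = Poly_Mapping.single i m"
      by (simp only: is_eq)
    also have "\<dots> = Poly_Mapping.single (hd is) (m div 2) + Poly_Mapping.single (hd is) (m div 2)"
      using half by (cases "m = 0") (simp_all add: is_eq flip: single_add)
    finally show ?thesis
      using nonneg[OF that] by (simp add: q_def power2_eq_square mult_single)
  qed (simp add: q_def)
  have hom: "homogeneous n (m div 2) (q is)" if "is \<in> tensor_indices m n" for "is"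
  proof (cases "m = 0")
    case False
    then have "is \<noteq> []" "set is \<subseteq> {1..n}"
      using that by (auto simp: tensor_indices_def)
    then have "hd is \<in> {1..n}" using hd_in_set by blast
    then show ?thesis by (auto simp: homogeneous_def q_def split: if_splits)
  qed (auto simp: homogeneous_def q_def)
  obtain iss where iss: "set iss = tensor_indices m n" "distinct iss"
    using finite_distinct_list[OF finite_tensor_indices] by blast
  have "tensor_poly m n A = (\<Sum>is \<in> tensor_indices m n. (q is)\<^sup>2)"
    unfolding tensor_poly_def by (rule sum.cong) (simp_all only: square)
  also have "\<dots> = (\<Sum>p \<leftarrow> map q iss. p\<^sup>2)"
    using iss by (simp add: sum_list_distinct_conv_sum_set o_def)
  finally show ?thesis
    unfolding sos_tensor_def using \<open>even m\<close> hom iss by (intro conjI exI[of _ "map q iss"]) auto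
qed

theorem proposition1:
  fixes n m :: nat and v :: "real vec" and A :: "nat list \<Rightarrow> real"
  assumes "odd n"
    and "truncated_hankel_tensor m n v A"
    and "\<forall>i \<in> {1..n}. v $ ((i - 1) * m) \<ge> 0"
  shows "(v $ ((n - 1) * m div 2) = 0 \<longrightarrow>
            strong_hankel_tensor m n A \<and> (even m \<longrightarrow> sos_tensor m n A))
       \<and> (v $ ((n - 1) * m div 2) > 0 \<and> (n - 1) * m > 4 \<longrightarrow>
            \<not> strong_hankel_tensor m n A)"
proof -
  define N where "N = (n - 1) * m"
  define h where "h = N div 2"
  have n: "1 \<le> n" using \<open>odd n\<close> by (cases n) auto
  have N: "N = 2 * h" using \<open>odd n\<close> by (simp add: N_def h_def)
  have hankel: "hankel_tensor m n v A"
    and trunc: "\<And>k. k \<le> N \<Longrightarrow> k \<notin> {0, h, N} \<Longrightarrow> v $ k = 0"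
    using assms(2) by (auto simp: truncated_hankel_tensor_def N_def h_def)
  have ends: "0 \<le> v $ 0" "0 \<le> v $ N"
    using bspec[OF assms(3), of 1] bspec[OF assms(3), of n] n by (simp_all add: N_def)
  define H where "H = hankel_matrix m n v"
  have "H = mat (Suc h) (Suc h) (\<lambda>(i, j). v $ (i + j))"
    unfolding H_def hankel_matrix_def h_def N_def by simp
  then have H: "H \<in> carrier_mat (Suc h) (Suc h)"
    and H_entry: "\<And>i j. i \<le> h \<Longrightarrow> j \<le> h \<Longrightarrow> H $$ (i, j) = v $ (i + j)"
    by auto
  have "strong_hankel_tensor m n A \<and> (even m \<longrightarrow> sos_tensor m n A)" if mid: "v $ h = 0"
  proof (intro conjI impI)
    have inner: "v $ k = 0" if "k \<le> N" "k \<noteq> 0" "k \<noteq> N" for k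
      using that trunc[of k] mid by (cases "k = h") auto
    have nonneg: "0 \<le> v $ k" if "k \<le> N" for k
      using that inner[of k] ends by (cases "k = 0"; cases "k = N") auto
    have "positive_semidefinite H"
      by (rule positive_semidefinite_diagonalI[OF H]) (auto simp: H_entry N intro!: inner nonneg)
    then show "strong_hankel_tensor m n A"
      using hankel N unfolding strong_hankel_tensor_def H_def N_def by auto
    assume "even m"
    have entry: "A is = v $ (sum_list is - m)" "sum_list is - m \<le> N"
      if "is \<in> tensor_indices m n" for "is"
      using that hankel tensor_indices_sum_bounds[OF that]
      by (auto simp: hankel_tensor_def N_def algebra_simps)
    show "sos_tensor m n A"
    proof (rule sos_tensor_diagonalI[OF \<open>even m\<close>])
      fix "is" assume is_in: "is \<in> tensor_indices m n"
      show "0 \<le> A is" using entry[OF is_in] nonneg by simp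
      assume "A is \<noteq> 0"
      then have "sum_list is - m = 0 \<or> sum_list is - m = N"
        using entry[OF is_in] inner by metis
      moreover have "m + N = n * m" using n by (simp add: N_def algebra_simps)
      ultimately have "sum_list is = m \<or> sum_list is = n * m"
        using tensor_indices_sum_bounds(1)[OF is_in] by auto
      then show "\<exists>i. is = replicate m i"
        by (rule tensor_indices_extreme_sum_constant[OF is_in])
    qed
  qed
  moreover have "\<not> strong_hankel_tensor m n A" if "v $ h > 0" "N > 4"
  proof
    assume "strong_hankel_tensor m n A"
    then obtain w where "hankel_tensor m n w A" "positive_semidefinite (hankel_matrix m n w)"
      by (auto simp: strong_hankel_tensor_def)
    then have "positive_semidefinite H"
      using hankel_tensor_generating_vector_unique[OF n hankel] by (auto simp: H_def)
    moreover have h: "3 \<le> h" using \<open>N > 4\<close> N by simp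
    ultimately have "2 * H $$ (1, h - 1) \<le> H $$ (1, 1) + H $$ (h - 1, h - 1)"
      using H by (intro positive_semidefinite_offdiag_le) auto
    moreover have "H $$ (1, h - 1) = v $ h" "H $$ (1, 1) = v $ 2"
      using h H_entry[of 1 "h - 1"] H_entry[of 1 1] by (simp_all add: numeral_2_eq_2)
    moreover have "H $$ (h - 1, h - 1) = v $ (2 * h - 2)"
      using H_entry[of "h - 1" "h - 1"] by (simp add: diff_mult_distrib2 flip: mult_2)
    moreover have "v $ 2 = 0" "v $ (2 * h - 2) = 0"
      using h by (auto intro!: trunc simp: N)
    ultimately show False using \<open>v $ h > 0\<close> by simp
  qed
  ultimately show ?thesis unfolding h_def N_def by blast
qed

end
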